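(* Let $J$ be a Lipschitz-continuous almost complex structure on $\mathbb R^{2n}$ and let $u:\Delta\to(\mathbb R^{2n},J)$ be a $J$-holomorphic map. Then $u\in\mathcal C^{1,LnLip}$, i.e. the differential of $u$ is Log-Lipschitz-continuous (on every compact subset of $\Delta$).
   Context: $\Delta$ is the open unit disc in $\mathbb C$. $J$ is a matrix-valued function with $J^2=-\mathrm{id}$. A $J$-holomorphic map is a $\mathcal C^1$-map with $\partial_xu+J(u)\partial_yu=0$. A map $f$ from a compact set $K\subset\mathbb R^m$ to a normed space is Log-Lipschitz-continuous if $$\|f\|_{L^\infty(K)}+\sup\left\{\frac{|f(x)-f(y)|}{|x-y|\ln\frac1{|x-y|}}:x\ne y\in K,\ |x-y|\le\tfrac12\right\}<\infty.$$ *)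

theory Defs
  imports "HOL-Analysis.Analysis"
begin

text \<open>
  The differential as an element of the normed space of bounded linear maps. It is
  meaningful only where \<open>u\<close> is differentiable, since \<^const>\<open>Blinfun\<close> is unspecified on
  functions that are not bounded linear.
\<close>

definition differential ::
    "('a::euclidean_space \<Rightarrow> 'b::real_normed_vector) \<Rightarrow> 'a \<Rightarrow> 'a \<Rightarrow>\<^sub>L 'b" where
  "differential u z = Blinfun (frechet_derivative u (at z))"

definition C1_on ::
    "'a::euclidean_space set \<Rightarrow> ('a \<Rightarrow> 'b::real_normed_vector) \<Rightarrow> bool" where
  "C1_on U u \<longleftrightarrow>
     (\<forall>z\<in>U. u differentiable at z) \<and> continuous_on U (differential u)"

text \<open>
  Suprema are taken in \<^typ>\<open>ennreal\<close>, so that an unbounded supremum is \<^term>\<open>\<infinity>\<close> and the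
  supremum over an empty set of pairs is \<open>0\<close>. The supremum norm on \<open>K\<close> is the pointwise one.
\<close>

definition log_lipschitz_norm ::
    "'a::euclidean_space set \<Rightarrow> ('a \<Rightarrow> 'b::real_normed_vector) \<Rightarrow> ennreal" where
  "log_lipschitz_norm K f =
     (SUP x\<in>K. ennreal (norm (f x))) +
     Sup {ennreal (norm (f x - f y) / (norm (x - y) * ln (1 / norm (x - y)))) |x y.
            x \<in> K \<and> y \<in> K \<and> x \<noteq> y \<and> norm (x - y) \<le> 1 / 2}"

definition log_lipschitz_on ::
    "'a::euclidean_space set \<Rightarrow> ('a \<Rightarrow> 'b::real_normed_vector) \<Rightarrow> bool" where
  "log_lipschitz_on K f \<longleftrightarrow> log_lipschitz_norm K f < \<infinity>"

definition C1_LnLip_on ::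
    "'a::euclidean_space set \<Rightarrow> ('a \<Rightarrow> 'b::real_normed_vector) \<Rightarrow> bool" where
  "C1_LnLip_on U u \<longleftrightarrow>
     C1_on U u \<and> (\<forall>K. compact K \<and> K \<subseteq> U \<longrightarrow> log_lipschitz_on K (differential u))"

definition almost_complex_structure :: "(real ^ 'm \<Rightarrow> real ^ 'm ^ 'm) \<Rightarrow> bool" where
  "almost_complex_structure J \<longleftrightarrow> (\<forall>p. J p ** J p = - mat 1)"

definition partial_x :: "(complex \<Rightarrow> 'b::real_normed_vector) \<Rightarrow> complex \<Rightarrow> 'b" where
  "partial_x u z = vector_derivative (\<lambda>t. u (Complex t (Im z))) (at (Re z))"

definition partial_y :: "(complex \<Rightarrow> 'b::real_normed_vector) \<Rightarrow> complex \<Rightarrow> 'b" where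
  "partial_y u z = vector_derivative (\<lambda>t. u (Complex (Re z) t)) (at (Im z))"

definition J_holomorphic_on ::
    "(real ^ 'm \<Rightarrow> real ^ 'm ^ 'm) \<Rightarrow> complex set \<Rightarrow> (complex \<Rightarrow> real ^ 'm) \<Rightarrow> bool" where
  "J_holomorphic_on J U u \<longleftrightarrow>
     C1_on U u \<and> (\<forall>z\<in>U. partial_x u z + J (u z) *v partial_y u z = 0)"

end

theory Submission imports Defs begin

text \<open>
  Formally \<open>u\<close> satisfies \<open>\<Delta>u = (\<partial>\<^sub>y J(u)) \<partial>\<^sub>x u - (\<partial>\<^sub>x J(u)) \<partial>\<^sub>y u\<close>, which is bounded because
  \<open>J \<circ> u\<close> is Lipschitz; so the gradient of \<open>u\<close> is log-Lipschitz. To use this without derivatives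
  of \<open>J\<close>, let \<open>rho\<close> be a radial bump function with \<open>w rho(w) = - \<nabla>eta(w)\<close> and average at scale \<open>r\<close>:
  \<open>D\<^sub>a(z, r) = \<integral> rho(w) \<partial>\<^sub>a u(z + r w) dw\<close>. Integration by parts gives
  \<open>\<partial>\<^sub>r D\<^sub>a = (1/r) \<integral> \<nabla>(\<partial>\<^sub>a eta) \<cdot> \<nabla>u(z + r w) dw\<close>, and since the Laplacian of \<open>u\<close> is bounded in the
  weak sense, the integral is \<open>O(r)\<close>. Hence \<open>D\<^sub>a(z, r)\<close> differs from a multiple of \<open>\<partial>\<^sub>a u(z)\<close> by
  \<open>O(r)\<close>. The same computation with \<open>\<partial>\<^sub>a \<partial>\<^sub>b eta\<close> shows that \<open>\<partial>\<^sub>b D\<^sub>a\<close> has \<open>r\<close>-derivative \<open>O(1/r)\<close>,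
  so that \<open>\<partial>\<^sub>b D\<^sub>a = O(ln (1/r))\<close>. Comparing two points at the scale \<open>r = |z - z'|\<close> gives the claim.
\<close>

subsection \<open>The radial kernel\<close>

text \<open>A truncated polynomial in place of a smooth cutoff: each derivative lowers the index by
  one, so \<open>bump 5\<close> still has continuous fourth derivatives.\<close>

definition bump :: "nat \<Rightarrow> complex \<Rightarrow> real" where
  "bump k w = max 0 (1 - w \<bullet> w) ^ k"

lemma max_0_power_has_real_derivative:
  "((\<lambda>x::real. max 0 x ^ Suc (Suc k)) has_real_derivative real (Suc (Suc k)) * max 0 x ^ Suc k) (at x)"
proof -
  consider "x > 0" | "x < 0" | "x = 0" by linarith
  then show ?thesis
  proof cases
    case 1
    have "((\<lambda>x::real. x ^ Suc (Suc k)) has_real_derivative real (Suc (Suc k)) * max 0 x ^ Suc k) (at x)"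
      using DERIV_pow[of "Suc (Suc k)" x] 1 by simp
    then show ?thesis
      by (rule has_field_derivative_transform_within_open[where S = "{0<..}"]) (use 1 in auto)
  next
    case 2
    have "((\<lambda>x::real. 0) has_real_derivative real (Suc (Suc k)) * max 0 x ^ Suc k) (at x)"
      using 2 by simp
    then show ?thesis
      by (rule has_field_derivative_transform_within_open[where S = "{..<0}"]) (use 2 in auto)
  next
    case 3
    \<comment> \<open>At the kink the difference quotient is 0 for \<open>h < 0\<close> and a
      positive power of \<open>h\<close> for \<open>h > 0\<close>, hence dominated by
      \<open>norm h\<close> near 0.\<close>
    have "((\<lambda>h::real. max 0 h ^ Suc (Suc k) / h) \<longlongrightarrow> 0) (at 0)"
    proof (rule tendsto_norm_zero_cancel, rule tendsto_0_le[where K = 1])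
      show "((\<lambda>h::real. h) \<longlongrightarrow> 0) (at 0)" by simp
      show "\<forall>\<^sub>F h::real in at 0. norm (norm (max 0 h ^ Suc (Suc k) / h)) \<le> norm h * 1"
        unfolding eventually_at
      proof (intro exI[of _ 1] conjI ballI impI)
        fix h :: real assume "h \<noteq> 0 \<and> dist h 0 < 1"
        then show "norm (norm (max 0 h ^ Suc (Suc k) / h)) \<le> norm h * 1"
          using power_le_one[of h k] mult_left_mono[of "h^k" 1 h]
          by (cases "h > 0") (auto simp: max_def)
      qed simp
    qed
    then show ?thesis unfolding DERIV_def 3 by simp
  qed
qed

lemma bump_has_derivative:
  assumes "k \<ge> 2"
  shows "(bump k has_derivative (\<lambda>d. - 2 * real k * (d \<bullet> w) * bump (k - 1) w)) (at w)"
proof -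
  obtain j where k: "k = Suc (Suc j)" using assms by (metis add_2_eq_Suc le_Suc_ex)
  have "((\<lambda>w::complex. 1 - w \<bullet> w) has_derivative (\<lambda>d. - 2 * (d \<bullet> w))) (at w)"
    by (rule has_derivative_eq_rhs, (rule derivative_intros)+) (simp add: inner_commute)
  from has_derivative_compose[OF this
      max_0_power_has_real_derivative[of j, unfolded has_field_derivative_def]]
  show ?thesis unfolding bump_def[abs_def] k
    by (rule has_derivative_eq_rhs) (simp add: fun_eq_iff algebra_simps)
qed

lemma continuous_bump [continuous_intros]: "continuous_on S (bump k)"
  unfolding bump_def by (intro continuous_intros)

lemma bump_eq_0: "norm w \<ge> 1 \<Longrightarrow> k > 0 \<Longrightarrow> bump k w = 0"
  using one_le_power[of "norm w" 2] by (simp add: bump_def dot_square_norm)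

text \<open>
  With \<open>rho = bump 4\<close> and \<open>eta = bump 5 / 10\<close>, the functions \<open>rho1, rho2\<close> and
  \<open>eta1, \<dots>, eta4\<close> are the iterated directional derivatives of \<open>rho\<close> and \<open>eta\<close>. They are
  tied together by \<open>grad eta w = - rho w *\<^sub>R w\<close>.
\<close>
definition rho1 :: "complex \<Rightarrow> complex \<Rightarrow> real" where
  "rho1 a w = - 8 * (a \<bullet> w) * bump 3 w"

definition rho2 :: "complex \<Rightarrow> complex \<Rightarrow> complex \<Rightarrow> real" where
  "rho2 a b w = - 8 * (a \<bullet> b) * bump 3 w + 48 * (a \<bullet> w) * (b \<bullet> w) * bump 2 w"

definition eta1 :: "complex \<Rightarrow> complex \<Rightarrow> real" where
  "eta1 a w = - (a \<bullet> w) * bump 4 w"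

definition eta2 :: "complex \<Rightarrow> complex \<Rightarrow> complex \<Rightarrow> real" where
  "eta2 a b w = - (a \<bullet> b) * bump 4 w + 8 * (a \<bullet> w) * (b \<bullet> w) * bump 3 w"

definition eta3 :: "complex \<Rightarrow> complex \<Rightarrow> complex \<Rightarrow> complex \<Rightarrow> real" where
  "eta3 a b c w = 8 * ((a \<bullet> b) * (c \<bullet> w) + (a \<bullet> c) * (b \<bullet> w) + (b \<bullet> c) * (a \<bullet> w)) * bump 3 w
     - 48 * (a \<bullet> w) * (b \<bullet> w) * (c \<bullet> w) * bump 2 w"

definition eta4 :: "complex \<Rightarrow> complex \<Rightarrow> complex \<Rightarrow> complex \<Rightarrow> complex \<Rightarrow> real" where
  "eta4 a b c d w =
     8 * ((a \<bullet> b) * (c \<bullet> d) + (a \<bullet> c) * (b \<bullet> d) + (b \<bullet> c) * (a \<bullet> d)) * bump 3 w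
     - 48 * ((a \<bullet> b) * (c \<bullet> w) * (d \<bullet> w) + (a \<bullet> c) * (b \<bullet> w) * (d \<bullet> w)
           + (b \<bullet> c) * (a \<bullet> w) * (d \<bullet> w) + (a \<bullet> d) * (b \<bullet> w) * (c \<bullet> w)
           + (b \<bullet> d) * (a \<bullet> w) * (c \<bullet> w) + (c \<bullet> d) * (a \<bullet> w) * (b \<bullet> w)) * bump 2 w
     + 192 * (a \<bullet> w) * (b \<bullet> w) * (c \<bullet> w) * (d \<bullet> w) * bump 1 w"

lemmas kernel_defs = rho1_def rho2_def eta1_def eta2_def eta3_def eta4_def

lemmas bump_derivs = bump_has_derivative[of 2, simplified] bump_has_derivative[of 3, simplified]
  bump_has_derivative[of 4, simplified]

lemma inner_left_has_derivative: "((\<lambda>w. a \<bullet> w) has_derivative (\<lambda>d. a \<bullet> d)) (at w)"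
  by (rule has_derivative_inner_right[OF has_derivative_ident])

lemmas kernel_deriv_rules = has_derivative_add has_derivative_diff has_derivative_mult has_derivative_minus
   has_derivative_const inner_left_has_derivative bump_derivs

lemma rho_has_derivative:
  "(bump 4 has_derivative (\<lambda>d. rho1 d w)) (at w)"
  "(rho1 a has_derivative (\<lambda>d. rho2 a d w)) (at w)"
  unfolding kernel_defs[abs_def]
  by (rule has_derivative_eq_rhs, (rule kernel_deriv_rules)+, rule ext, simp add: algebra_simps)+

lemma eta_has_derivative:
  "(eta1 a has_derivative (\<lambda>d. eta2 a d w)) (at w)"
  "(eta2 a b has_derivative (\<lambda>d. eta3 a b d w)) (at w)"
  "(eta3 a b c has_derivative (\<lambda>d. eta4 a b c d w)) (at w)"
  unfolding kernel_defs[abs_def]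
  by (rule has_derivative_eq_rhs, (rule kernel_deriv_rules)+, rule ext, simp add: algebra_simps)+

lemma continuous_kernels [continuous_intros]:
  "continuous_on S (rho1 a)" "continuous_on S (rho2 a b)" "continuous_on S (eta1 a)"
  "continuous_on S (eta2 a b)" "continuous_on S (eta3 a b c)" "continuous_on S (eta4 a b c d)"
  unfolding kernel_defs[abs_def] by (intro continuous_intros)+

lemma kernels_eq_0:
  assumes "norm w \<ge> 1"
  shows "rho1 a w = 0" "rho2 a b w = 0" "eta1 a w = 0" "eta2 a b w = 0" "eta3 a b c w = 0"
  using assms by (simp_all add: kernel_defs bump_eq_0)

text \<open>This is the derivative in direction \<open>a\<close> of
  \<open>bump 4 w * (c \<bullet> w) = - eta1 c w\<close>. It converts the position factor created by
  differentiating in the radius into second derivatives of eta.\<close>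

lemma rho_position_eq:
  "rho1 a w * (c \<bullet> w) = - eta2 a c w - (a \<bullet> c) * bump 4 w"
  by (simp add: kernel_defs algebra_simps)

text \<open>One more derivative of the previous identity, in direction \<open>b\<close>; the two
  \<open>rho1\<close> terms are product-rule remainders.\<close>

lemma rho2_position_eq:
  "rho2 a b w * (c \<bullet> w) = - eta3 a b c w - (a \<bullet> c) * rho1 b w - (b \<bullet> c) * rho1 a w"
  by (simp add: kernel_defs algebra_simps)

lemma rho2_commute: "rho2 a b = rho2 b a"
  by (rule ext) (simp add: rho2_def inner_commute[of a b])

text \<open>Equality of mixed derivatives, which supplies the symmetry hypothesis of
  \<open>weak_laplacian_bound\<close> for the gradient \<open>eta2 a\<close>.\<close>

lemma eta3_commute: "eta3 a b c = eta3 a c b"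
  by (rule ext) (simp add: eta3_def inner_commute[of c b] algebra_simps)

lemma eta4_commute: "eta4 a b c d = eta4 a b d c"
  by (rule ext) (simp add: eta4_def inner_commute[of d c] algebra_simps)

subsection \<open>Integration by parts\<close>

text \<open>The kernels live on the unit disc; the margin allows shifts of that disc by up to 1/2,
  and the square stays well inside \<open>ball 0 4\<close>.\<close>

abbreviation square :: "complex set" where
  "square \<equiv> cbox (Complex (-2) (-2)) (Complex 2 2)"

lemma norm_lt_3_if_square: "w \<in> square \<Longrightarrow> norm w < 3"
proof -
  assume "w \<in> square"
  then have "\<bar>Re w\<bar> \<le> 2" "\<bar>Im w\<bar> \<le> 2" by (auto simp: in_cbox_complex_iff)
  then have "(Re w)\<^sup>2 \<le> 2\<^sup>2" "(Im w)\<^sup>2 \<le> 2\<^sup>2" by (metis abs_le_square_iff abs_numeral)+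
  then have "(norm w)\<^sup>2 < 3\<^sup>2" by (simp add: cmod_power2)
  then show ?thesis by (rule power2_less_imp_less) simp
qed

text \<open>The integral of a compactly supported function does not change under translation.\<close>
lemma integral_derivative_eq_0:
  fixes F :: "complex \<Rightarrow> 'b::euclidean_space"
  assumes F: "\<And>w. w \<in> ball 0 4 \<Longrightarrow> (F has_derivative F' w) (at w)"
    and F': "continuous_on (ball 0 4) (\<lambda>w. F' w e)"
    and F0: "\<And>w. norm w \<ge> 1 \<Longrightarrow> F w = 0"
    and e: "norm e \<le> 1"
  shows "integral square (\<lambda>w. F' w e) = 0"
proof -
  define T where "T = {-1/2<..<1/2::real}"
  have small: "norm (t *\<^sub>R e) \<le> 1/2" if "t \<in> T" for t
    using that mult_mono[of "\<bar>t\<bar>" "1/2" "norm e" 1] e by (auto simp: T_def)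
  have ball: "w + t *\<^sub>R e \<in> ball 0 4" if "t \<in> T" "w \<in> square" for t w
    using norm_triangle_ineq[of w "t *\<^sub>R e"] small[OF that(1)] norm_lt_3_if_square[OF that(2)]
    by simp
  have D: "((\<lambda>t. integral square (\<lambda>w. F (w + t *\<^sub>R e))) has_vector_derivative
      integral square (\<lambda>w. F' (w + 0 *\<^sub>R e) e)) (at 0 within T)"
  proof (rule leibniz_rule_vector_derivative)
    fix t w assume tw: "t \<in> T" "w \<in> square"
    have "((\<lambda>t. w + t *\<^sub>R e) has_derivative (\<lambda>s. s *\<^sub>R e)) (at t within T)"
      by (auto intro!: derivative_eq_intros)
    from has_derivative_compose[OF this F[OF ball[OF tw]]]
    show "((\<lambda>t. F (w + t *\<^sub>R e)) has_vector_derivative F' (w + t *\<^sub>R e) e) (at t within T)"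
      unfolding has_vector_derivative_def
      using linear_scale[OF has_derivative_linear[OF F[OF ball[OF tw]]]] by simp
  next
    fix t assume t: "t \<in> T"
    have "continuous_on (ball 0 4) F"
      using F has_derivative_continuous by (blast intro: continuous_at_imp_continuous_on)
    then show "(\<lambda>w. F (w + t *\<^sub>R e)) integrable_on square"
      using ball[OF t]
      by (intro integrable_continuous, elim continuous_on_compose2) (auto intro!: continuous_intros)
  next
    show "continuous_on (T \<times> square) (\<lambda>(t, w). F' (w + t *\<^sub>R e) e)"
      unfolding split_beta
      by (rule continuous_on_compose2[OF F', of _ "\<lambda>p. snd p + fst p *\<^sub>R e"])
        (use ball in \<open>auto intro!: continuous_intros\<close>)
  qed (auto simp: T_def)
  \<comment> \<open>For a small shift the moved square still contains the support of
    \<open>F\<close>, so the integral is the one over the whole plane.\<close>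
  have const: "integral square (\<lambda>w. F (w + t *\<^sub>R e)) = integral UNIV F" if t: "t \<in> T" for t
  proof -
    define c where "c = t *\<^sub>R e"
    have c: "\<bar>Re c\<bar> \<le> 1/2" "\<bar>Im c\<bar> \<le> 1/2"
      using small[OF t] abs_Re_le_cmod[of c] abs_Im_le_cmod[of c] unfolding c_def by linarith+
    have 0: "F w = 0" if "w \<notin> cbox (Complex (-2) (-2) + c) (Complex 2 2 + c)" for w
      using that c abs_Re_le_cmod[of w] abs_Im_le_cmod[of w]
      by (intro F0) (auto simp: in_cbox_complex_iff)
    have "integral square (\<lambda>w. F (w + c)) = integral (cbox (Complex (-2) (-2) + c) (Complex 2 2 + c)) F"
      using integral_shift_cbox[of "Complex (-2) (-2) + c" c "Complex 2 2 + c" F] by simp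
    also have "\<dots> = integral UNIV F"
      using 0 by (subst integral_restrict_UNIV[symmetric]) (metis (full_types))
    finally show ?thesis by (simp add: c_def)
  qed
  have "((\<lambda>t. integral UNIV F) has_vector_derivative
      integral square (\<lambda>w. F' (w + 0 *\<^sub>R e) e)) (at 0 within T)"
    by (rule has_vector_derivative_transform[OF _ _ D]) (simp_all add: const, simp add: T_def)
  moreover have "at 0 within T = at 0" by (rule at_within_open) (auto simp: T_def)
  ultimately have "((\<lambda>t. integral UNIV F) has_vector_derivative integral square (\<lambda>w. F' w e)) (at (0::real))"
    by simp
  then show ?thesis
    using vector_derivative_unique_at[OF _ has_vector_derivative_const] by blast
qed

locale c1_map =
  fixes u :: "complex \<Rightarrow> 'b::euclidean_space" and U :: "complex \<Rightarrow> complex \<Rightarrow>\<^sub>L 'b"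
    and S :: "complex set"
  assumes deriv: "z \<in> S \<Longrightarrow> (u has_derivative blinfun_apply (U z)) (at z)"
    and cont_U: "continuous_on S U"
begin

lemma cont_u: "continuous_on S u"
  using deriv has_derivative_continuous by (blast intro: continuous_at_imp_continuous_on)

text \<open>The affine path covers both later uses: varying the radius (\<open>a w = z\<close>,
  \<open>b w = w\<close>) and moving the centre (\<open>a w = z + r *\<^sub>R w\<close>,
  \<open>b\<close> constant).\<close>

lemma integral_has_vector_derivative:
  assumes cont [continuous_intros]: "continuous_on square \<psi>" "continuous_on square a" "continuous_on square b"
    and T: "convex T" "\<tau> \<in> T"
    and S: "\<And>t w. t \<in> T \<Longrightarrow> w \<in> square \<Longrightarrow> a w + t *\<^sub>R b w \<in> S"
  shows "((\<lambda>t. integral square (\<lambda>w. \<psi> w *\<^sub>R u (a w + t *\<^sub>R b w))) has_vector_derivative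
      integral square (\<lambda>w. \<psi> w *\<^sub>R U (a w + \<tau> *\<^sub>R b w) (b w))) (at \<tau> within T)"
proof (rule leibniz_rule_vector_derivative)
  fix t w assume tw: "t \<in> T" "w \<in> square"
  have "((\<lambda>t. a w + t *\<^sub>R b w) has_derivative (\<lambda>s. s *\<^sub>R b w)) (at t within T)"
    by (auto intro!: derivative_eq_intros)
  from has_derivative_scaleR_right[OF has_derivative_compose[OF this deriv[OF S[OF tw]]]]
  show "((\<lambda>t. \<psi> w *\<^sub>R u (a w + t *\<^sub>R b w)) has_vector_derivative
      \<psi> w *\<^sub>R U (a w + t *\<^sub>R b w) (b w)) (at t within T)"
    unfolding has_vector_derivative_def
    by (rule has_derivative_eq_rhs) (simp add: blinfun.scaleR_right scaleR_left_commute fun_eq_iff)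
next
  fix t assume t: "t \<in> T"
  show "(\<lambda>w. \<psi> w *\<^sub>R u (a w + t *\<^sub>R b w)) integrable_on square"
    using S[OF t]
    by (intro integrable_continuous continuous_intros continuous_on_compose2[OF cont_u]) auto
next
  show "continuous_on (T \<times> square) (\<lambda>(t, w). \<psi> w *\<^sub>R U (a w + t *\<^sub>R b w) (b w))"
    unfolding split_beta
    by (intro continuous_intros continuous_on_compose2[OF cont_U]
        continuous_on_compose2[OF cont(1)] continuous_on_compose2[OF cont(2)]
        continuous_on_compose2[OF cont(3)])
      (use S in auto)
qed (use T in auto)

context
  fixes z :: complex and r :: real
  assumes zr: "\<And>w. w \<in> ball 0 4 \<Longrightarrow> z + r *\<^sub>R w \<in> S"
begin

lemma continuous_on_square:
  "continuous_on square (\<lambda>w. u (z + r *\<^sub>R w))"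
  "continuous_on square (\<lambda>w. U (z + r *\<^sub>R w))"
  using zr norm_lt_3_if_square
  by (auto intro!: continuous_intros continuous_on_compose2[OF cont_u]
      continuous_on_compose2[OF cont_U]) force+

text \<open>The product of \<open>\<psi>\<close> with the rescaled \<open>u\<close> is supported in
  the closed unit disc, so its directional derivative integrates to 0; the chain rule contributes
  the factor \<open>r\<close>.\<close>

lemma integral_by_parts:
  assumes \<psi>: "\<And>w. (\<psi> has_derivative (\<lambda>d. \<psi>' d w)) (at w)"
    and [continuous_intros]: "\<And>S. continuous_on S (\<psi>' e)"
    and \<psi>0: "\<And>w. norm w \<ge> 1 \<Longrightarrow> \<psi> w = 0"
    and e: "norm e \<le> 1"
  shows "integral square (\<lambda>w. \<psi>' e w *\<^sub>R u (z + r *\<^sub>R w)) =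
    - r *\<^sub>R integral square (\<lambda>w. \<psi> w *\<^sub>R U (z + r *\<^sub>R w) e)"
proof -
  have [continuous_intros]: "continuous_on S \<psi>" for S
    using \<psi> has_derivative_continuous by (blast intro: continuous_at_imp_continuous_on)
  have "integral square (\<lambda>w. r *\<^sub>R \<psi> w *\<^sub>R U (z + r *\<^sub>R w) e + \<psi>' e w *\<^sub>R u (z + r *\<^sub>R w)) = 0"
  proof (rule integral_derivative_eq_0[where F = "\<lambda>w. \<psi> w *\<^sub>R u (z + r *\<^sub>R w)"
        and F' = "\<lambda>w d. r *\<^sub>R \<psi> w *\<^sub>R U (z + r *\<^sub>R w) d + \<psi>' d w *\<^sub>R u (z + r *\<^sub>R w)"])
    fix w :: complex assume w: "w \<in> ball 0 4"
    have "((\<lambda>w. z + r *\<^sub>R w) has_derivative (\<lambda>d. r *\<^sub>R d)) (at w)"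
      by (auto intro!: derivative_eq_intros)
    from has_derivative_scaleR[OF \<psi> has_derivative_compose[OF this deriv[OF zr[OF w]]]]
    show "((\<lambda>w. \<psi> w *\<^sub>R u (z + r *\<^sub>R w)) has_derivative
       (\<lambda>d. r *\<^sub>R \<psi> w *\<^sub>R U (z + r *\<^sub>R w) d + \<psi>' d w *\<^sub>R u (z + r *\<^sub>R w))) (at w)"
      by (simp add: blinfun.scaleR_right mult.commute)
  next
    show "continuous_on (ball 0 4) (\<lambda>w. r *\<^sub>R \<psi> w *\<^sub>R U (z + r *\<^sub>R w) e + \<psi>' e w *\<^sub>R u (z + r *\<^sub>R w))"
      by (intro continuous_intros continuous_on_compose2[OF cont_u]
          continuous_on_compose2[OF cont_U]) (use zr in auto)
  qed (use \<psi>0 e in auto)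
  moreover have "(\<lambda>w. r *\<^sub>R \<psi> w *\<^sub>R U (z + r *\<^sub>R w) e) integrable_on square"
    "(\<lambda>w. \<psi>' e w *\<^sub>R u (z + r *\<^sub>R w)) integrable_on square"
    by (intro integrable_continuous continuous_intros continuous_on_square)+
  ultimately have "r *\<^sub>R integral square (\<lambda>w. \<psi> w *\<^sub>R U (z + r *\<^sub>R w) e)
      + integral square (\<lambda>w. \<psi>' e w *\<^sub>R u (z + r *\<^sub>R w)) = 0"
    by (simp only: integral_add integral_cmul)
  from minus_unique[OF this] show ?thesis by simp
qed

end

end

lemma onorm_scaleR_left_le: "onorm (\<lambda>x::real. x *\<^sub>R v) \<le> norm v"
  by (rule onorm_bound) (auto simp: mult.commute)

lemma blinfun_apply_complex:
  "blinfun_apply A w = (1 \<bullet> w) *\<^sub>R blinfun_apply A 1 + (\<i> \<bullet> w) *\<^sub>R blinfun_apply A \<i>"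
proof -
  have "w = (1 \<bullet> w) *\<^sub>R 1 + (\<i> \<bullet> w) *\<^sub>R \<i>" by (simp add: complex_eq_iff inner_complex_def)
  then show ?thesis by (metis blinfun.add_right blinfun.scaleR_right)
qed

subsection \<open>The weak Laplacian\<close>

text \<open>Cauchy-Schwarz in each row; \<open>norm A\<close> is the Euclidean norm of all
  entries.\<close>

lemma norm_matrix_vector_mult_le: "norm (A *v x) \<le> norm A * norm (x :: real ^ 'm)"
proof -
  have "norm (A *v x) \<le> L2_set (\<lambda>i. norm (A $ i) * norm x) UNIV"
    unfolding norm_vec_def[of "A *v x"]
    by (rule L2_set_mono)
      (auto simp: matrix_vector_mul_component intro: Cauchy_Schwarz_ineq2)
  also have "\<dots> = norm A * norm x"
    by (simp add: norm_vec_def[of A] L2_set_left_distrib)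
  finally show ?thesis .
qed

text \<open>Centres range over the disc of radius \<open>R\<close> and scales up to
  \<open>r0\<close>; the 4 matches \<open>ball 0 4\<close>, so every sampled point stays in a
  compact disc on which \<open>M\<close> bounds the differential. The relation
  \<open>J^2 = -1\<close> enters through having the equation in both forms \<open>U_1\<close> and
  \<open>U_ii\<close>.\<close>

locale j_disc = c1_map u U "ball 0 1"
  for u :: "complex \<Rightarrow> real ^ 'm" and U +
  fixes J :: "real ^ 'm \<Rightarrow> real ^ 'm ^ 'm" and L R r0 M :: real
  assumes U_1: "z \<in> ball 0 1 \<Longrightarrow> U z 1 = - (J (u z) *v U z \<i>)"
    and U_ii: "z \<in> ball 0 1 \<Longrightarrow> U z \<i> = J (u z) *v U z 1"
    and lip: "L-lipschitz_on UNIV J"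
    and radii: "0 \<le> R" "0 < r0" "R + 4 * r0 < 1"
    and M: "\<And>z. norm z \<le> R + 4 * r0 \<Longrightarrow> norm (U z) \<le> M"
begin

lemma in_disc:
  assumes "norm z \<le> R" "\<bar>r\<bar> \<le> r0" "w \<in> ball 0 4"
  shows "norm (z + r *\<^sub>R w) \<le> R + 4 * r0" "z + r *\<^sub>R w \<in> ball 0 1"
proof -
  have "norm (r *\<^sub>R w) \<le> r0 * 4"
    using assms(2,3) unfolding norm_scaleR by (intro mult_mono) auto
  then show "norm (z + r *\<^sub>R w) \<le> R + 4 * r0"
    using norm_triangle_ineq[of z "r *\<^sub>R w"] assms(1) by linarith
  then show "z + r *\<^sub>R w \<in> ball 0 1" using radii by simp
qed

lemma M_nonneg: "0 \<le> M"
  using M[of 0] radii norm_ge_zero[of "U 0"] by (simp del: norm_ge_zero)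

lemma J_u_lipschitz:
  assumes "norm w \<le> R + 4 * r0" "norm z \<le> R + 4 * r0"
  shows "norm (J (u w) - J (u z)) \<le> L * M * norm (w - z)"
proof -
  have "norm (u w - u z) \<le> M * norm (w - z)"
  proof (rule differentiable_bound[of "cball 0 (R + 4 * r0)"])
    fix x :: complex assume "x \<in> cball 0 (R + 4 * r0)"
    then show "(u has_derivative U x) (at x within cball 0 (R + 4 * r0))" "onorm (U x) \<le> M"
      using M[of x] radii by (auto intro!: has_derivative_at_withinI deriv simp flip: norm_blinfun.rep_eq)
  qed (use assms in auto)
  moreover have "norm (J (u w) - J (u z)) \<le> L * norm (u w - u z)"
    using lipschitz_onD[OF lip, of "u w" "u z"] by (simp add: dist_norm)
  ultimately show ?thesis
    using lipschitz_on_nonneg[OF lip] mult_left_mono[of _ "M * norm (w - z)" L] by fastforce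
qed

lemma norm_U_apply: "norm z \<le> R + 4 * r0 \<Longrightarrow> norm e \<le> 1 \<Longrightarrow> norm (U z e) \<le> M"
  using norm_blinfun[of "U z" e] M[of z] mult_left_le[of "norm e" "norm (U z)"] by simp

text \<open>Here \<open>\<phi> c\<close> stands for the derivative of a test function in direction
  \<open>c\<close>. For twice differentiable \<open>u\<close>, integration by parts would give
  \<open>-r\<close> times the integral of the test function against the Laplacian of
  \<open>u\<close>, whence the expected size O(r).\<close>

definition weak_laplacian :: "(complex \<Rightarrow> complex \<Rightarrow> real) \<Rightarrow> complex \<Rightarrow> real \<Rightarrow> real ^ 'm" where
  "weak_laplacian \<phi> z r =
     integral square (\<lambda>w. \<phi> 1 w *\<^sub>R U (z + r *\<^sub>R w) 1 + \<phi> \<i> w *\<^sub>R U (z + r *\<^sub>R w) \<i>)"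

text \<open>Formally \<open>u\<close> has a bounded Laplacian. In this weak form, the only derivatives of
  \<open>J \<circ> u\<close> that would occur are replaced by the differences \<open>J (u w) - J (u z)\<close>, since
  \<open>\<phi> 1 *\<^sub>R U \<i> - \<phi> \<i> *\<^sub>R U 1\<close> has integral 0.\<close>
lemma weak_laplacian_bound:
  assumes \<phi>: "\<And>c w. (\<phi> c has_derivative (\<lambda>d. \<phi>' c d w)) (at w)"
    and \<phi>' [continuous_intros]: "\<And>c d S. continuous_on S (\<phi>' c d)"
    and sym: "\<phi>' 1 \<i> = \<phi>' \<i> 1"
    and \<phi>0: "\<And>c w. norm w \<ge> 1 \<Longrightarrow> \<phi> c w = 0"
  shows "\<exists>C\<ge>0. \<forall>z r. norm z \<le> R \<longrightarrow> 0 < r \<longrightarrow> r \<le> r0 \<longrightarrow>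
    norm (weak_laplacian \<phi> z r) \<le> C * r"
proof -
  have cont [continuous_intros]: "continuous_on S (\<phi> c)" for S c
    using \<phi> has_derivative_continuous by (blast intro: continuous_at_imp_continuous_on)
  have "\<exists>B\<ge>0. \<forall>w\<in>square. \<bar>\<phi> c w\<bar> \<le> B" for c
  proof -
    have "bounded (\<phi> c ` square)"
      by (intro compact_imp_bounded compact_continuous_image cont compact_cbox)
    then obtain B where "\<forall>x\<in>\<phi> c ` square. norm x \<le> B" unfolding bounded_iff by blast
    then have "max 0 B \<ge> 0 \<and> (\<forall>w\<in>square. \<bar>\<phi> c w\<bar> \<le> max 0 B)" by force
    then show ?thesis by blast
  qed
  then obtain B where B: "\<And>c. 0 \<le> B c" "\<And>c w. w \<in> square \<Longrightarrow> \<bar>\<phi> c w\<bar> \<le> B c" by metis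
  \<comment> \<open>The factors are the Lipschitz constant of \<open>J \<circ> u\<close>, the
    distance to the centre in units of \<open>r\<close>, the bound on \<open>f\<close> below, and
    the area of the square.\<close>
  define K where "K = L * M * 3 * ((B 1 + B \<i>) * M) * measure lborel square"
  have L: "0 \<le> L" by (rule lipschitz_on_nonneg[OF lip])
  show ?thesis
  proof (intro exI[of _ K] conjI allI impI)
    show "0 \<le> K" unfolding K_def using L B(1) M_nonneg by (intro mult_nonneg_nonneg add_nonneg_nonneg) auto
    fix z :: complex and r :: real assume z: "norm z \<le> R" and r: "0 < r" "r \<le> r0"
    have zr: "z + r *\<^sub>R w \<in> ball 0 1" "norm (z + r *\<^sub>R w) \<le> R + 4 * r0" if "w \<in> ball 0 4" for w
      using in_disc[OF z _ that, of r] r by auto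
    have bx4: "w \<in> ball 0 4" if "w \<in> square" for w using norm_lt_3_if_square[OF that] by simp
    \<comment> \<open>The equation gives \<open>g = J(u) f\<close> pointwise, and \<open>f\<close>
      integrates to 0 because it is a determinant of two gradients.\<close>
    define f where "f w = \<phi> \<i> w *\<^sub>R U (z + r *\<^sub>R w) 1 - \<phi> 1 w *\<^sub>R U (z + r *\<^sub>R w) \<i>" for w
    define g where "g w = \<phi> 1 w *\<^sub>R U (z + r *\<^sub>R w) 1 + \<phi> \<i> w *\<^sub>R U (z + r *\<^sub>R w) \<i>" for w
    have contU [continuous_intros]: "continuous_on square (\<lambda>w. U (z + r *\<^sub>R w))"
      by (rule continuous_on_square(2)[OF zr(1)])
    \<comment> \<open>Both sides equal minus the integral of the same mixed derivative
      \<open>\<phi>' 1 \<i>\<close> against \<open>u\<close>.\<close>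
    have "r *\<^sub>R integral square (\<lambda>w. \<phi> \<i> w *\<^sub>R U (z + r *\<^sub>R w) 1)
        = r *\<^sub>R integral square (\<lambda>w. \<phi> 1 w *\<^sub>R U (z + r *\<^sub>R w) \<i>)"
      using integral_by_parts[OF zr(1), of "\<phi> 1" "\<phi>' 1" \<i>]
        integral_by_parts[OF zr(1), of "\<phi> \<i>" "\<phi>' \<i>" 1] \<phi> \<phi>0 sym \<phi>' by auto
    then have int_f: "integral square f = 0"
      unfolding f_def using r(1)
      by (subst integral_diff) (auto intro!: integrable_continuous continuous_intros)
    have g: "g w = J (u (z + r *\<^sub>R w)) *v f w" if "w \<in> square" for w
    proof -
      note w = zr(1)[OF bx4[OF that]]
      have "J (u (z + r *\<^sub>R w)) *v U (z + r *\<^sub>R w) \<i> = - U (z + r *\<^sub>R w) 1"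
        by (subst U_1[OF w]) simp
      then show ?thesis
        by (simp add: f_def g_def matrix_vector_mult_diff_distrib matrix_vector_mult_scaleR
            flip: U_ii[OF w])
    qed
    have cf: "continuous_on square f" "continuous_on square g"
      unfolding f_def g_def by (intro continuous_intros)+
    have cA: "continuous_on square (\<lambda>w. J (u z) *v f w)"
      by (rule bounded_linear.continuous_on[OF matrix_vector_mul_bounded_linear cf(1)])
    \<comment> \<open>The matrix frozen at the centre passes through the integral and contributes
      nothing; what remains is the oscillation of \<open>J \<circ> u\<close>, which is O(r).\<close>
    have "integral square (\<lambda>w. J (u z) *v f w) = 0"
      using integral_linear[OF integrable_continuous[OF cf(1)] matrix_vector_mul_bounded_linear, of "J (u z)"]
        int_f by (simp add: o_def)
    then have "integral square g = integral square (\<lambda>w. g w - J (u z) *v f w)"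
      using cf cA by (subst integral_diff) (auto intro: integrable_continuous)
    also have "norm \<dots> \<le> L * M * (3 * r) * ((B 1 + B \<i>) * M) * measure lborel square"
    proof (rule has_integral_bound)
      show "((\<lambda>w. g w - J (u z) *v f w) has_integral integral square (\<lambda>w. g w - J (u z) *v f w)) square"
        using cf cA by (intro integrable_integral integrable_continuous continuous_intros)
      show "0 \<le> L * M * (3 * r) * ((B 1 + B \<i>) * M)"
        using L B(1) M_nonneg r by (intro mult_nonneg_nonneg add_nonneg_nonneg) auto
      fix w assume w: "w \<in> square"
      have "norm (f w) \<le> B \<i> * M + B 1 * M"
        unfolding f_def using zr(2)[OF bx4[OF w]] B w
        by (intro order_trans[OF norm_triangle_ineq4] add_mono)
          (auto intro!: mult_mono norm_U_apply)
      moreover have "norm (J (u (z + r *\<^sub>R w)) - J (u z)) \<le> L * M * (3 * r)"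
      proof -
        have "norm (z + r *\<^sub>R w - z) \<le> 3 * r" using norm_lt_3_if_square[OF w] r by simp
        then have "L * M * norm (z + r *\<^sub>R w - z) \<le> L * M * (3 * r)"
          using L M_nonneg by (intro mult_left_mono) auto
        then show ?thesis
          using J_u_lipschitz[OF zr(2)[OF bx4[OF w]], of z] z radii by linarith
      qed
      ultimately have "norm ((J (u (z + r *\<^sub>R w)) - J (u z)) *v f w)
          \<le> L * M * (3 * r) * ((B 1 + B \<i>) * M)"
        using L M_nonneg r
        by (intro order_trans[OF norm_matrix_vector_mult_le] mult_mono) (auto simp: algebra_simps)
      then show "norm (g w - J (u z) *v f w) \<le> L * M * (3 * r) * ((B 1 + B \<i>) * M)"
        by (simp add: g[OF w] matrix_vector_mult_diff_rdistrib)
    qed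
    finally show "norm (weak_laplacian \<phi> z r) \<le> K * r"
      by (simp add: weak_laplacian_def K_def g_def[abs_def] mult_ac)
  qed
qed

subsection \<open>Averages of the gradient\<close>

text \<open>Left unnormalised; the mass of \<open>bump 4\<close> reappears in
  \<open>mean_approximates\<close>.\<close>

definition mean :: "complex \<Rightarrow> complex \<Rightarrow> real \<Rightarrow> real ^ 'm" where
  "mean a z r = integral square (\<lambda>w. bump 4 w *\<^sub>R U (z + r *\<^sub>R w) a)"

text \<open>\<open>- hess a b z r / r\<close> is the derivative of \<open>mean a\<close> at \<open>z\<close> in the direction \<open>b\<close>.\<close>
definition hess :: "complex \<Rightarrow> complex \<Rightarrow> complex \<Rightarrow> real \<Rightarrow> real ^ 'm" where
  "hess a b z r = integral square (\<lambda>w. rho1 b w *\<^sub>R U (z + r *\<^sub>R w) a)"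

lemma weak_laplacian_eta2_bound:
  "\<exists>C\<ge>0. \<forall>z r. norm z \<le> R \<longrightarrow> 0 < r \<longrightarrow> r \<le> r0 \<longrightarrow> norm (weak_laplacian (eta2 a) z r) \<le> C * r"
  by (rule weak_laplacian_bound[of _ "eta3 a"])
    (rule eta_has_derivative continuous_kernels eta3_commute kernels_eq_0 | assumption)+

lemma weak_laplacian_eta3_bound:
  "\<exists>C\<ge>0. \<forall>z r. norm z \<le> R \<longrightarrow> 0 < r \<longrightarrow> r \<le> r0 \<longrightarrow> norm (weak_laplacian (eta3 a b) z r) \<le> C * r"
  by (rule weak_laplacian_bound[of _ "eta4 a b"])
    (rule eta_has_derivative continuous_kernels eta4_commute kernels_eq_0 | assumption)+

lemma disc_ball: "norm z \<le> R \<Longrightarrow> \<bar>r\<bar> \<le> r0 \<Longrightarrow> w \<in> square \<Longrightarrow> z + r *\<^sub>R w \<in> ball 0 1"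
  using in_disc(2)[of z r w] norm_lt_3_if_square[of w] by simp

lemma disc_cont [continuous_intros]:
  assumes "norm z \<le> R" "\<bar>r\<bar> \<le> r0"
  shows "continuous_on square (\<lambda>w. U (z + r *\<^sub>R w))"
  by (rule continuous_on_square(2)[OF in_disc(2)[OF assms]])

text \<open>With the derivative moved onto the kernel, the average involves \<open>u\<close> alone
  and can be differentiated in radius and centre although \<open>u\<close> is merely C1.\<close>

lemma mean_eq:
  assumes "norm z \<le> R" "0 < r" "r \<le> r0" "norm a \<le> 1"
  shows "mean a z r = - (1 / r) *\<^sub>R integral square (\<lambda>w. rho1 a w *\<^sub>R u (z + r *\<^sub>R w))"
  using integral_by_parts[OF in_disc(2)[OF assms(1), of r], where \<psi> = "bump 4" and \<psi>' = rho1 and e = a] assms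
  by (auto simp: mean_def rho_has_derivative bump_eq_0 continuous_kernels)

lemma hess_eq:
  assumes "norm z \<le> R" "0 < r" "r \<le> r0" "norm a \<le> 1"
  shows "hess a b z r = - (1 / r) *\<^sub>R integral square (\<lambda>w. rho2 b a w *\<^sub>R u (z + r *\<^sub>R w))"
  using integral_by_parts[OF in_disc(2)[OF assms(1), of r], where \<psi> = "rho1 b" and \<psi>' = "rho2 b" and e = a] assms
  by (auto simp: hess_def rho_has_derivative kernels_eq_0 continuous_kernels)

text \<open>No second derivatives of \<open>u\<close> are available; the symmetry is read off the
  kernel \<open>rho2\<close> after integration by parts.\<close>

lemma hess_commute:
  assumes "norm z \<le> R" "0 < r" "r \<le> r0" "norm a \<le> 1" "norm b \<le> 1"
  shows "hess a b z r = hess b a z r"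
  using assms by (simp add: hess_eq rho2_commute[of a b])

section \<open>Evolution of the averages in the radius\<close>

lemma radial_derivative:
  assumes "norm z \<le> R" "0 < r" "r < r0" "continuous_on square \<psi>"
  shows "((\<lambda>r. integral square (\<lambda>w. \<psi> w *\<^sub>R u (z + r *\<^sub>R w))) has_vector_derivative
      integral square (\<lambda>w. \<psi> w *\<^sub>R U (z + r *\<^sub>R w) w)) (at r)"
proof -
  have "((\<lambda>r. integral square (\<lambda>w. \<psi> w *\<^sub>R u (z + r *\<^sub>R w))) has_vector_derivative
      integral square (\<lambda>w. \<psi> w *\<^sub>R U (z + r *\<^sub>R w) w)) (at r within {0<..<r0})"
    using assms disc_ball by (intro integral_has_vector_derivative) (auto intro!: continuous_intros)
  then show ?thesis using assms by (simp add: at_within_open[of r "{0<..<r0}"])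
qed

text \<open>By \<open>mean_eq\<close> the average is \<open>-G / r\<close>. The position identity
  splits the derivative of \<open>G\<close> into minus the weak Laplacian and minus the mean; the
  derivative of the factor \<open>1 / r\<close> cancels the latter.\<close>

lemma mean_has_vector_derivative:
  assumes z: "norm z \<le> R" and r: "0 < r" "r < r0" and a: "norm a \<le> 1"
  shows "(mean a z has_vector_derivative (1 / r) *\<^sub>R weak_laplacian (eta2 a) z r) (at r)"
proof -
  define G where "G r = integral square (\<lambda>w. rho1 a w *\<^sub>R u (z + r *\<^sub>R w))" for r
  have r': "\<bar>r\<bar> \<le> r0" using r by simp
  have "integral square (\<lambda>w. rho1 a w *\<^sub>R U (z + r *\<^sub>R w) w) =
    integral square (\<lambda>w. - (eta2 a 1 w *\<^sub>R U (z + r *\<^sub>R w) 1 + eta2 a \<i> w *\<^sub>R U (z + r *\<^sub>R w) \<i>)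
       - bump 4 w *\<^sub>R U (z + r *\<^sub>R w) a)"
  proof (rule integral_cong)
    fix w
    have "rho1 a w *\<^sub>R blinfun_apply A w =
       - (eta2 a 1 w *\<^sub>R A 1 + eta2 a \<i> w *\<^sub>R A \<i>) - bump 4 w *\<^sub>R A a" for A :: "complex \<Rightarrow>\<^sub>L (real ^ 'm)"
      unfolding blinfun_apply_complex[of A w] blinfun_apply_complex[of A a] scaleR_add_right
        scaleR_scaleR rho_position_eq
      by (simp add: algebra_simps inner_commute[of a])
    then show "rho1 a w *\<^sub>R U (z + r *\<^sub>R w) w =
       - (eta2 a 1 w *\<^sub>R U (z + r *\<^sub>R w) 1 + eta2 a \<i> w *\<^sub>R U (z + r *\<^sub>R w) \<i>)
       - bump 4 w *\<^sub>R U (z + r *\<^sub>R w) a" .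
  qed
  also have "\<dots> = - weak_laplacian (eta2 a) z r - mean a z r"
  proof -
    have "(\<lambda>w. eta2 a 1 w *\<^sub>R U (z + r *\<^sub>R w) 1 + eta2 a \<i> w *\<^sub>R U (z + r *\<^sub>R w) \<i>) integrable_on square"
      "(\<lambda>w. bump 4 w *\<^sub>R U (z + r *\<^sub>R w) a) integrable_on square"
      by (intro integrable_continuous continuous_intros disc_cont z r')+
    then show ?thesis
      by (simp only: weak_laplacian_def mean_def integral_diff integral_neg integrable_neg)
  qed
  finally have G': "(G has_vector_derivative (- weak_laplacian (eta2 a) z r - mean a z r)) (at r)"
    using radial_derivative[OF z r, of "rho1 a"] unfolding G_def[abs_def]
    by (simp add: continuous_kernels)
  have "((\<lambda>r. - (1 / r)) has_real_derivative 1 / r\<^sup>2) (at r)"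
    using r by (auto intro!: derivative_eq_intros simp: power2_eq_square)
  from has_vector_derivative_scaleR[OF this G']
  have "((\<lambda>r. - (1 / r) *\<^sub>R G r) has_vector_derivative
     - (1 / r) *\<^sub>R (- weak_laplacian (eta2 a) z r - mean a z r) + (1 / r\<^sup>2) *\<^sub>R G r) (at r)" .
  also have "- (1 / r) *\<^sub>R (- weak_laplacian (eta2 a) z r - mean a z r) + (1 / r\<^sup>2) *\<^sub>R G r = (1 / r) *\<^sub>R weak_laplacian (eta2 a) z r"
    using mean_eq[OF z r(1) _ a] r by (simp add: G_def power2_eq_square scaleR_diff_right)
  finally show ?thesis
    by (rule has_vector_derivative_transform_within_open[where S = "{0<..<r0}"])
      (use z r a in \<open>auto simp: mean_eq G_def\<close>)
qed

text \<open>Now \<open>hess a b z r / r = -G / r^2\<close>. The two product-rule remainders coincide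
  by symmetry and amount to twice \<open>hess\<close>, which is exactly what the derivative of
  \<open>1 / r^2\<close> removes.\<close>

lemma hess_has_vector_derivative:
  assumes z: "norm z \<le> R" and r: "0 < r" "r < r0" and ab: "norm a \<le> 1" "norm b \<le> 1"
  shows "((\<lambda>r. (1 / r) *\<^sub>R hess a b z r) has_vector_derivative (1 / r\<^sup>2) *\<^sub>R weak_laplacian (eta3 b a) z r) (at r)"
proof -
  define G where "G r = integral square (\<lambda>w. rho2 b a w *\<^sub>R u (z + r *\<^sub>R w))" for r
  have r': "\<bar>r\<bar> \<le> r0" using r by simp
  have "integral square (\<lambda>w. rho2 b a w *\<^sub>R U (z + r *\<^sub>R w) w) =
    integral square (\<lambda>w. - (eta3 b a 1 w *\<^sub>R U (z + r *\<^sub>R w) 1 + eta3 b a \<i> w *\<^sub>R U (z + r *\<^sub>R w) \<i>)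
       - rho1 b w *\<^sub>R U (z + r *\<^sub>R w) a - rho1 a w *\<^sub>R U (z + r *\<^sub>R w) b)"
  proof (rule integral_cong)
    fix w
    have "rho2 b a w *\<^sub>R blinfun_apply A w =
       - (eta3 b a 1 w *\<^sub>R A 1 + eta3 b a \<i> w *\<^sub>R A \<i>) - rho1 b w *\<^sub>R A a - rho1 a w *\<^sub>R A b"
      for A :: "complex \<Rightarrow>\<^sub>L (real ^ 'm)"
      unfolding blinfun_apply_complex[of A w] blinfun_apply_complex[of A a]
        blinfun_apply_complex[of A b] scaleR_add_right scaleR_scaleR rho2_position_eq
      by (simp add: algebra_simps inner_commute[of a] inner_commute[of b])
    then show "rho2 b a w *\<^sub>R U (z + r *\<^sub>R w) w =
       - (eta3 b a 1 w *\<^sub>R U (z + r *\<^sub>R w) 1 + eta3 b a \<i> w *\<^sub>R U (z + r *\<^sub>R w) \<i>)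
       - rho1 b w *\<^sub>R U (z + r *\<^sub>R w) a - rho1 a w *\<^sub>R U (z + r *\<^sub>R w) b" .
  qed
  also have "\<dots> = - weak_laplacian (eta3 b a) z r - hess a b z r - hess b a z r"
  proof -
    have "(\<lambda>w. eta3 b a 1 w *\<^sub>R U (z + r *\<^sub>R w) 1 + eta3 b a \<i> w *\<^sub>R U (z + r *\<^sub>R w) \<i>) integrable_on square"
      "(\<lambda>w. rho1 b w *\<^sub>R U (z + r *\<^sub>R w) a) integrable_on square"
      "(\<lambda>w. rho1 a w *\<^sub>R U (z + r *\<^sub>R w) b) integrable_on square"
      by (intro integrable_continuous continuous_intros disc_cont z r')+
    then show ?thesis
      by (simp only: weak_laplacian_def hess_def integral_diff integral_neg integrable_neg integrable_diff)
  qed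
  also have "\<dots> = - weak_laplacian (eta3 b a) z r - 2 *\<^sub>R hess a b z r"
    using hess_commute[OF z r(1) _ ab] r by (simp add: scaleR_2)
  finally have G': "(G has_vector_derivative (- weak_laplacian (eta3 b a) z r - 2 *\<^sub>R hess a b z r)) (at r)"
    using radial_derivative[OF z r, of "rho2 b a"] unfolding G_def[abs_def]
    by (simp add: continuous_kernels)
  have "((\<lambda>r. - (1 / r\<^sup>2)) has_real_derivative 2 / r ^ 3) (at r)"
    using r by (auto intro!: derivative_eq_intros simp: power2_eq_square power3_eq_cube)
  from has_vector_derivative_scaleR[OF this G']
  have "((\<lambda>r. - (1 / r\<^sup>2) *\<^sub>R G r) has_vector_derivative
     - (1 / r\<^sup>2) *\<^sub>R (- weak_laplacian (eta3 b a) z r - 2 *\<^sub>R hess a b z r) + (2 / r ^ 3) *\<^sub>R G r) (at r)" .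
  also have "- (1 / r\<^sup>2) *\<^sub>R (- weak_laplacian (eta3 b a) z r - 2 *\<^sub>R hess a b z r) + (2 / r ^ 3) *\<^sub>R G r
      = (1 / r\<^sup>2) *\<^sub>R weak_laplacian (eta3 b a) z r"
    using hess_eq[OF z r(1) _ ab(1), of b] r
    by (simp add: G_def power2_eq_square power3_eq_cube scaleR_diff_right)
  finally show ?thesis
    by (rule has_vector_derivative_transform_within_open[where S = "{0<..<r0}"])
      (use z r ab in \<open>auto simp: hess_eq G_def power2_eq_square\<close>)
qed

text \<open>The weak Laplacian estimate bounds the derivative in the radius, so the average moves at
  most linearly away from its value at radius 0.\<close>

lemma mean_approximates:
  assumes a: "norm a \<le> 1"
  shows "\<exists>C\<ge>0. \<forall>z r. norm z \<le> R \<longrightarrow> 0 < r \<longrightarrow> r < r0 \<longrightarrow>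
    norm (mean a z r - integral square (bump 4) *\<^sub>R U z a) \<le> C * r"
proof -
  obtain C where C: "0 \<le> C"
    "\<And>z r. norm z \<le> R \<Longrightarrow> 0 < r \<Longrightarrow> r \<le> r0 \<Longrightarrow> norm (weak_laplacian (eta2 a) z r) \<le> C * r"
    using weak_laplacian_eta2_bound[of a] by blast
  have "norm (mean a z r - integral square (bump 4) *\<^sub>R U z a) \<le> C * r"
    if z: "norm z \<le> R" and r: "0 < r" "r < r0" for z r
  proof -
    \<comment> \<open>Continuity must reach radius 0 because the derivative formula holds for
      positive radii.\<close>
    have "continuous_on {0..r} (mean a z)"
      unfolding mean_def
    proof (rule integral_continuous_on_param)
      show "continuous_on ({0..r} \<times> square) (\<lambda>(r, w). bump 4 w *\<^sub>R U (z + r *\<^sub>R w) a)"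
        unfolding split_beta
        by (intro continuous_intros continuous_on_compose2[OF cont_U]
            continuous_on_compose2[OF continuous_bump[of UNIV]])
          (use disc_ball[OF z] r in auto)
    qed
    then have "norm (mean a z r - mean a z 0) \<le> C * r - C * 0"
    proof (rule differentiable_bound_general[OF r(1)])
      fix t assume t: "0 < t" "t < r"
      show "(mean a z has_vector_derivative (1 / t) *\<^sub>R weak_laplacian (eta2 a) z t) (at t)"
        using mean_has_vector_derivative[OF z _ _ a, of t] t r by simp
      show "((*) C has_vector_derivative C) (at t)"
        unfolding has_real_derivative_iff_has_vector_derivative[symmetric]
        by (auto intro!: derivative_eq_intros)
      show "norm ((1 / t) *\<^sub>R weak_laplacian (eta2 a) z t) \<le> C"
        using C(2)[OF z, of t] t r by (simp add: field_simps)
    qed (intro continuous_intros)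
    moreover have "mean a z 0 = integral square (bump 4) *\<^sub>R U z a"
      using integral_linear[OF integrable_continuous[OF continuous_bump] bounded_linear_scaleR_left]
      by (simp add: mean_def o_def)
    ultimately show ?thesis by simp
  qed
  then show ?thesis using C(1) by blast
qed

section \<open>Growth of the derivatives of the averages\<close>

lemma hess_bounded:
  "\<exists>C\<ge>0. \<forall>z. norm z \<le> R \<longrightarrow> norm a \<le> 1 \<longrightarrow> norm (hess a b z (r0 / 2)) \<le> C"
proof -
  have "bounded (rho1 b ` square)"
    by (intro compact_imp_bounded compact_continuous_image continuous_kernels compact_cbox)
  then obtain B where B: "\<And>w. w \<in> square \<Longrightarrow> \<bar>rho1 b w\<bar> \<le> B" unfolding bounded_iff by auto
  have B0: "0 \<le> B" using B[of 0] by (auto simp: in_cbox_complex_iff)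
  have "norm (hess a b z (r0 / 2)) \<le> B * M * measure lborel square" if z: "norm z \<le> R" and a: "norm a \<le> 1" for z
  proof (rule has_integral_bound)
    have r: "\<bar>r0 / 2\<bar> \<le> r0" using radii by simp
    show "((\<lambda>w. rho1 b w *\<^sub>R U (z + (r0 / 2) *\<^sub>R w) a) has_integral hess a b z (r0 / 2)) square"
      unfolding hess_def
      by (intro integrable_integral integrable_continuous continuous_intros disc_cont z r)
    fix w assume w: "w \<in> square"
    show "norm (rho1 b w *\<^sub>R U (z + (r0 / 2) *\<^sub>R w) a) \<le> B * M"
      using B[OF w] B0 norm_U_apply[OF in_disc(1)[OF z r] a, of w] norm_lt_3_if_square[OF w]
      by (auto intro!: mult_mono)
  qed (use B0 M_nonneg in auto)
  then show ?thesis using B0 M_nonneg by (intro exI[of _ "B * M * measure lborel square"]) auto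
qed

text \<open>The bound \<open>C / t\<close> on the radial derivative of \<open>hess / t\<close>,
  integrated from \<open>r\<close> up to \<open>r0 / 2\<close>, gives the logarithm; the value at
  the fixed scale \<open>r0 / 2\<close> gives the constant term.\<close>

lemma hess_bound:
  assumes ab: "norm a \<le> 1" "norm b \<le> 1"
  shows "\<exists>C\<ge>0. \<forall>z r. norm z \<le> R \<longrightarrow> 0 < r \<longrightarrow> r \<le> r0 / 2 \<longrightarrow>
    norm (hess a b z r) \<le> C * (r * (1 + ln (r0 / 2 / r)))"
proof -
  obtain C where C: "0 \<le> C"
    "\<And>z r. norm z \<le> R \<Longrightarrow> 0 < r \<Longrightarrow> r \<le> r0 \<Longrightarrow> norm (weak_laplacian (eta3 b a) z r) \<le> C * r"
    using weak_laplacian_eta3_bound[of b a] by blast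
  obtain C0 where C0: "0 \<le> C0" "\<And>z. norm z \<le> R \<Longrightarrow> norm (hess a b z (r0 / 2)) \<le> C0"
    using hess_bounded[of a b] ab by blast
  \<comment> \<open>Half of \<open>r0\<close>, because the derivative formula requires radii
    strictly below \<open>r0\<close>.\<close>
  define r1 where "r1 = r0 / 2"
  have r1: "0 < r1" "r1 < r0" using radii by (auto simp: r1_def)
  have "norm (hess a b z r) \<le> (C0 / r1 + C) * (r * (1 + ln (r1 / r)))"
    if z: "norm z \<le> R" and r: "0 < r" "r \<le> r1" for z r
  proof -
    let ?f = "\<lambda>r. (1 / r) *\<^sub>R hess a b z r"
    have f': "(?f has_vector_derivative (1 / t\<^sup>2) *\<^sub>R weak_laplacian (eta3 b a) z t) (at t)" if "r \<le> t" "t \<le> r1" for t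
      using hess_has_vector_derivative[OF z _ _ ab, of t] that r r1 by simp
    have "norm (?f r1 - ?f r) \<le> C * ln r1 - C * ln r"
    proof (cases "r = r1")
      case False
      then have "r < r1" using r by simp
      then show ?thesis
      proof (rule differentiable_bound_general)
        show "continuous_on {r..r1} ?f"
          using f' by (auto intro!: continuous_at_imp_continuous_on has_vector_derivative_continuous)
        show "continuous_on {r..r1} (\<lambda>t. C * ln t)"
          using r by (intro continuous_intros) auto
        fix t assume t: "r < t" "t < r1"
        show "(?f has_vector_derivative (1 / t\<^sup>2) *\<^sub>R weak_laplacian (eta3 b a) z t) (at t)"
          using f' t by simp
        show "((\<lambda>t. C * ln t) has_vector_derivative C / t) (at t)"
          unfolding has_real_derivative_iff_has_vector_derivative[symmetric]
          using t r by (auto intro!: derivative_eq_intros)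
        show "norm ((1 / t\<^sup>2) *\<^sub>R weak_laplacian (eta3 b a) z t) \<le> C / t"
          using C(2)[OF z, of t] t r r1 by (simp add: field_simps power2_eq_square)
      qed
    qed simp
    moreover have "norm (?f r1) \<le> C0 / r1"
      using C0(2)[OF z] r1 by (simp add: r1_def divide_right_mono)
    moreover have "norm (?f r) \<le> norm (?f r1) + norm (?f r1 - ?f r)"
      using norm_triangle_ineq4[of "?f r1" "?f r1 - ?f r"] by simp
    moreover have "C * ln r1 - C * ln r = C * ln (r1 / r)"
      using r r1 by (simp add: ln_div right_diff_distrib)
    ultimately have "norm (?f r) \<le> C0 / r1 + C * ln (r1 / r)" by linarith
    then have "norm (hess a b z r) \<le> (C0 / r1 + C * ln (r1 / r)) * r"
      using r by (simp add: divide_le_eq)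
    also have "\<dots> \<le> ((C0 / r1 + C) * (1 + ln (r1 / r))) * r"
    proof (rule mult_right_mono)
      have "0 \<le> C0 / r1 * ln (r1 / r)" using C0(1) r r1 by (intro mult_nonneg_nonneg) auto
      then show "C0 / r1 + C * ln (r1 / r) \<le> (C0 / r1 + C) * (1 + ln (r1 / r))"
        using C(1) by (simp add: algebra_simps)
    qed (use r in simp)
    finally show ?thesis by (simp add: mult_ac)
  qed
  then show ?thesis using C(1) C0(1) r1 unfolding r1_def[symmetric]
    by (intro exI[of _ "C0 / r1 + C"]) auto
qed

text \<open>Mean value inequality on the segment between the centres: the derivative is
  \<open>-1 / r\<close> times a combination of two \<open>hess\<close> terms with coefficients at
  most \<open>norm h\<close>, hence the factor 2.\<close>

lemma mean_diff:
  assumes z: "norm z \<le> R" "norm z' \<le> R" and r: "0 < r" "r \<le> r0" and a: "norm a \<le> 1"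
    and K: "\<And>z. norm z \<le> R \<Longrightarrow> norm (hess 1 a z r) \<le> K" "\<And>z. norm z \<le> R \<Longrightarrow> norm (hess \<i> a z r) \<le> K"
  shows "norm (mean a z' r - mean a z r) \<le> 2 * K / r * norm (z' - z)"
proof -
  define h where "h = z' - z"
  define f where "f t = - (1 / r) *\<^sub>R integral square (\<lambda>w. rho1 a w *\<^sub>R u ((z + r *\<^sub>R w) + t *\<^sub>R h))" for t
  have zt: "norm (z + t *\<^sub>R h) \<le> R" if "t \<in> {0..1}" for t
  proof -
    have "(1 - t) *\<^sub>R z + t *\<^sub>R z' \<in> cball 0 R"
      using that z by (intro convexD[OF convex_cball]) auto
    then show ?thesis by (simp add: h_def algebra_simps)
  qed
  have f: "mean a (z + t *\<^sub>R h) r = f t" if "t \<in> {0..1}" for t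
    using mean_eq[OF zt[OF that] r a] by (simp add: f_def algebra_simps)
  have f': "(f has_vector_derivative - (1 / r) *\<^sub>R ((1 \<bullet> h) *\<^sub>R hess 1 a (z + t *\<^sub>R h) r + (\<i> \<bullet> h) *\<^sub>R hess \<i> a (z + t *\<^sub>R h) r))
      (at t within {0..1})" if t: "t \<in> {0..1}" for t
  proof -
    have "((\<lambda>t. integral square (\<lambda>w. rho1 a w *\<^sub>R u ((z + r *\<^sub>R w) + t *\<^sub>R h))) has_vector_derivative
       integral square (\<lambda>w. rho1 a w *\<^sub>R U ((z + r *\<^sub>R w) + t *\<^sub>R h) h)) (at t within {0..1})"
    proof (rule integral_has_vector_derivative)
      fix t w assume "t \<in> {0..1::real}" "w \<in> square"
      then show "z + r *\<^sub>R w + t *\<^sub>R h \<in> ball 0 1"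
        using disc_ball[OF zt, of t r w] r by (simp add: add_ac)
    qed (use t in \<open>auto intro!: continuous_intros\<close>)
    moreover have "integral square (\<lambda>w. rho1 a w *\<^sub>R U ((z + r *\<^sub>R w) + t *\<^sub>R h) h)
       = (1 \<bullet> h) *\<^sub>R hess 1 a (z + t *\<^sub>R h) r + (\<i> \<bullet> h) *\<^sub>R hess \<i> a (z + t *\<^sub>R h) r"
    proof -
      have r': "\<bar>r\<bar> \<le> r0" using r by simp
      have I: "(\<lambda>w. c *\<^sub>R rho1 a w *\<^sub>R U (z + t *\<^sub>R h + r *\<^sub>R w) e) integrable_on square" for c e
        by (intro integrable_continuous continuous_intros disc_cont zt[OF t] r')
      have "rho1 a w *\<^sub>R U ((z + r *\<^sub>R w) + t *\<^sub>R h) h =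
        (1 \<bullet> h) *\<^sub>R rho1 a w *\<^sub>R U (z + t *\<^sub>R h + r *\<^sub>R w) 1 +
        (\<i> \<bullet> h) *\<^sub>R rho1 a w *\<^sub>R U (z + t *\<^sub>R h + r *\<^sub>R w) \<i>" for w
        by (subst blinfun_apply_complex) (simp add: algebra_simps)
      then show ?thesis
        by (simp only: integral_add[OF I I] integral_cmul hess_def)
    qed
    ultimately show ?thesis
      unfolding f_def[abs_def] by (intro bounded_linear.has_vector_derivative[OF bounded_linear_scaleR_right]) simp
  qed
  have "norm (f 1 - f 0) \<le> 2 * K / r * norm h * norm (1 - 0 :: real)"
  proof (rule differentiable_bound[of "{0..1}"])
    fix t :: real assume t: "t \<in> {0..1}"
    show "(f has_derivative (\<lambda>x. x *\<^sub>R (- (1 / r) *\<^sub>R ((1 \<bullet> h) *\<^sub>R hess 1 a (z + t *\<^sub>R h) r + (\<i> \<bullet> h) *\<^sub>R hess \<i> a (z + t *\<^sub>R h) r))))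
       (at t within {0..1})"
      using f'[OF t] by (simp add: has_vector_derivative_def)
    have "norm ((1 \<bullet> h) *\<^sub>R hess 1 a (z + t *\<^sub>R h) r + (\<i> \<bullet> h) *\<^sub>R hess \<i> a (z + t *\<^sub>R h) r)
       \<le> norm h * K + norm h * K"
      using K[OF zt[OF t]] Cauchy_Schwarz_ineq2[of 1 h] Cauchy_Schwarz_ineq2[of \<i> h]
      by (intro order_trans[OF norm_triangle_ineq] add_mono) (auto intro!: mult_mono)
    then have "norm (- (1 / r) *\<^sub>R ((1 \<bullet> h) *\<^sub>R hess 1 a (z + t *\<^sub>R h) r + (\<i> \<bullet> h) *\<^sub>R hess \<i> a (z + t *\<^sub>R h) r))
       \<le> 2 * K / r * norm h"
      using r unfolding norm_scaleR by (simp add: pos_divide_le_eq mult_ac)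
    then show "onorm (\<lambda>x. x *\<^sub>R (- (1 / r) *\<^sub>R ((1 \<bullet> h) *\<^sub>R hess 1 a (z + t *\<^sub>R h) r + (\<i> \<bullet> h) *\<^sub>R hess \<i> a (z + t *\<^sub>R h) r)))
       \<le> 2 * K / r * norm h"
      by (rule order_trans[OF onorm_scaleR_left_le])
  qed auto
  then show ?thesis using f[of 0] f[of 1] by (simp add: h_def)
qed

section \<open>Modulus of continuity of the differential\<close>

lemma integral_bump_pos: "0 < integral square (bump 4)"
proof -
  have "0 \<le> integral square (bump 4)"
    by (intro integral_nonneg integrable_continuous continuous_bump) (auto simp: bump_def)
  moreover have "integral square (bump 4) \<noteq> 0"
  proof
    assume "integral square (bump 4) = 0"
    then have "(bump 4 has_integral 0) square"
      by (metis integrable_integral integrable_continuous continuous_bump)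
    \<comment> \<open>A continuous nonnegative function with zero integral vanishes on the square,
      but \<open>bump 4 0 = 1\<close>.\<close>
    from has_integral_0_cbox_imp_0[OF continuous_bump _ this, of 0] show False
      by (auto simp: bump_def in_cbox_complex_iff in_box_complex_iff box_ne_empty Basis_complex_def)
  qed
  ultimately show ?thesis by simp
qed

text \<open>Both values of the differential are replaced by averages at the scale
  \<open>r = norm (z' - z)\<close> at a cost of O(r) each; the averages themselves differ by the
  logarithmic term from \<open>hess_bound\<close>.\<close>

lemma U_apply_modulus:
  assumes a: "norm a \<le> 1"
  shows "\<exists>C\<ge>0. \<forall>z z'. norm z \<le> R \<longrightarrow> norm z' \<le> R \<longrightarrow> z' \<noteq> z \<longrightarrow> norm (z' - z) \<le> r0 / 2 \<longrightarrow>
    norm (U z' a - U z a) \<le> C * (norm (z' - z) * (1 + ln (r0 / 2 / norm (z' - z))))"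
proof -
  define c where "c = integral square (bump 4)"
  have c: "0 < c" unfolding c_def by (rule integral_bump_pos)
  obtain C1 where C1: "0 \<le> C1" "\<And>z r. norm z \<le> R \<Longrightarrow> 0 < r \<Longrightarrow> r < r0 \<Longrightarrow> norm (mean a z r - c *\<^sub>R U z a) \<le> C1 * r"
    using mean_approximates[OF a] unfolding c_def by blast
  obtain C2 where C2: "0 \<le> C2" "\<And>z r. norm z \<le> R \<Longrightarrow> 0 < r \<Longrightarrow> r \<le> r0 / 2 \<Longrightarrow>
      norm (hess 1 a z r) \<le> C2 * (r * (1 + ln (r0 / 2 / r)))"
    using hess_bound[OF _ a, of 1] by auto
  obtain C3 where C3: "0 \<le> C3" "\<And>z r. norm z \<le> R \<Longrightarrow> 0 < r \<Longrightarrow> r \<le> r0 / 2 \<Longrightarrow>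
      norm (hess \<i> a z r) \<le> C3 * (r * (1 + ln (r0 / 2 / r)))"
    using hess_bound[OF _ a, of \<i>] by auto
  define C where "C = (2 * C1 + 2 * (C2 + C3)) / c"
  have "norm (U z' a - U z a) \<le> C * (norm (z' - z) * (1 + ln (r0 / 2 / norm (z' - z))))"
    if z: "norm z \<le> R" "norm z' \<le> R" "z' \<noteq> z" and le: "norm (z' - z) \<le> r0 / 2" for z z'
  proof -
    define r where "r = norm (z' - z)"
    have r: "0 < r" "r \<le> r0 / 2" "r < r0" using z le radii by (auto simp: r_def)
    define l where "l = 1 + ln (r0 / 2 / r)"
    have l: "1 \<le> l" using r by (simp add: l_def)
    \<comment> \<open>The divisor \<open>r\<close> in \<open>mean_diff\<close> cancels against the
      distance of the centres, which is \<open>r\<close> itself.\<close>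
    have "norm (mean a z' r - mean a z r) \<le> 2 * ((C2 + C3) * (r * l)) / r * norm (z' - z)"
    proof (rule mean_diff)
      fix z :: complex assume "norm z \<le> R"
      note hess = C2(2)[OF this r(1,2)] C3(2)[OF this r(1,2)]
      show "norm (hess 1 a z r) \<le> (C2 + C3) * (r * l)" "norm (hess \<i> a z r) \<le> (C2 + C3) * (r * l)"
      proof -
        have "0 \<le> C2 * (r * l)" "0 \<le> C3 * (r * l)" using C2(1) C3(1) r l by simp_all
        with hess show "norm (hess 1 a z r) \<le> (C2 + C3) * (r * l)" "norm (hess \<i> a z r) \<le> (C2 + C3) * (r * l)"
          unfolding l_def[symmetric] distrib_right by linarith+
      qed
    qed (use z r a in auto)
    also have "\<dots> = 2 * (C2 + C3) * (r * l)" using r by (simp add: r_def[symmetric])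
    finally have m: "norm (mean a z' r - mean a z r) \<le> 2 * (C2 + C3) * (r * l)" .
    have "c * norm (U z' a - U z a) = norm (c *\<^sub>R U z' a - c *\<^sub>R U z a)"
      using c by (simp flip: scaleR_diff_right)
    also have "\<dots> = norm ((mean a z' r - mean a z r) + ((mean a z r - c *\<^sub>R U z a) - (mean a z' r - c *\<^sub>R U z' a)))"
      by simp
    also have "\<dots> \<le> 2 * (C2 + C3) * (r * l) + (C1 * r + C1 * r)"
      using z r by (intro order_trans[OF norm_triangle_ineq] add_mono m order_trans[OF norm_triangle_ineq4] C1)
    also have "\<dots> \<le> 2 * (C2 + C3) * (r * l) + 2 * C1 * (r * l)"
      using C1(1) r l mult_left_mono[of 1 l "C1 * r"] by (simp add: mult_ac)
    finally have "norm (U z' a - U z a) \<le> C * (r * l)"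
      using c by (simp add: C_def field_simps)
    then show ?thesis by (simp add: r_def l_def)
  qed
  moreover have "0 \<le> C" using C1 C2 C3 c by (simp add: C_def)
  ultimately show ?thesis by blast
qed

end

subsection \<open>Log-Lipschitz continuity\<close>

text \<open>Real bounds give finiteness in \<open>ennreal\<close>; distances at most 1/2 make the
  logarithm positive, so the quotient can be cleared.\<close>

lemma log_lipschitz_onI:
  assumes B: "\<And>x. x \<in> K \<Longrightarrow> norm (f x) \<le> B"
    and C: "\<And>x y. x \<in> K \<Longrightarrow> y \<in> K \<Longrightarrow> x \<noteq> y \<Longrightarrow> norm (x - y) \<le> 1 / 2 \<Longrightarrow>
      norm (f x - f y) \<le> C * (norm (x - y) * ln (1 / norm (x - y)))"
  shows "log_lipschitz_on K f"
proof -
  have "(SUP x\<in>K. ennreal (norm (f x))) \<le> ennreal B"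
    using B by (intro SUP_least ennreal_leI)
  moreover have "Sup {ennreal (norm (f x - f y) / (norm (x - y) * ln (1 / norm (x - y)))) |x y.
            x \<in> K \<and> y \<in> K \<and> x \<noteq> y \<and> norm (x - y) \<le> 1 / 2} \<le> ennreal C"
  proof (rule Sup_least, elim CollectE exE conjE, hypsubst, rule ennreal_leI)
    fix x y assume xy: "x \<in> K" "y \<in> K" "x \<noteq> y" "norm (x - y) \<le> 1 / 2"
    have "0 < norm (x - y)" using xy by simp
    moreover from this have "0 < ln (1 / norm (x - y))"
      using xy(4) by (intro ln_gt_zero) (simp add: field_simps)
    ultimately show "norm (f x - f y) / (norm (x - y) * ln (1 / norm (x - y))) \<le> C"
      using C[OF xy] by (simp add: pos_divide_le_eq)
  qed
  ultimately have "log_lipschitz_norm K f \<le> ennreal B + ennreal C"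
    unfolding log_lipschitz_norm_def by (rule add_mono)
  also have "\<dots> < \<infinity>" by simp
  finally show ?thesis by (simp add: log_lipschitz_on_def)
qed

lemma norm_blinfun_complex_le:
  "norm A \<le> norm (blinfun_apply A 1) + norm (blinfun_apply A \<i>)"
proof (rule norm_blinfun_bound)
  fix w
  have "norm (blinfun_apply A w) \<le> norm w * norm (A 1) + norm w * norm (A \<i>)"
    unfolding blinfun_apply_complex[of A w]
    using Cauchy_Schwarz_ineq2[of 1 w] Cauchy_Schwarz_ineq2[of \<i> w]
    by (intro order_trans[OF norm_triangle_ineq] add_mono) (auto intro!: mult_mono)
  then show "norm (blinfun_apply A w) \<le> (norm (A 1) + norm (A \<i>)) * norm w"
    by (simp add: algebra_simps)
qed simp

lemma (in j_disc) log_lipschitz_on_U: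
  assumes K: "K \<subseteq> cball 0 R"
  shows "log_lipschitz_on K U"
proof -
  define r1 where "r1 = r0 / 2"
  have r1: "0 < r1" "r1 < 1" using radii by (auto simp: r1_def)
  obtain C1 where C1: "0 \<le> C1" "\<And>z z'. norm z \<le> R \<Longrightarrow> norm z' \<le> R \<Longrightarrow> z' \<noteq> z \<Longrightarrow> norm (z' - z) \<le> r1 \<Longrightarrow>
    norm (U z' 1 - U z 1) \<le> C1 * (norm (z' - z) * (1 + ln (r1 / norm (z' - z))))"
    using U_apply_modulus[of 1] unfolding r1_def by auto
  obtain C2 where C2: "0 \<le> C2" "\<And>z z'. norm z \<le> R \<Longrightarrow> norm z' \<le> R \<Longrightarrow> z' \<noteq> z \<Longrightarrow> norm (z' - z) \<le> r1 \<Longrightarrow>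
    norm (U z' \<i> - U z \<i>) \<le> C2 * (norm (z' - z) * (1 + ln (r1 / norm (z' - z))))"
    using U_apply_modulus[of \<i>] unfolding r1_def by auto
  have M_K: "norm (U z) \<le> M" if "z \<in> K" for z
    using that K radii by (intro M) force
  \<comment> \<open>The first summand serves pairs at distance at most \<open>r1\<close>, the second
    the remaining pairs, where the crude bound \<open>2 * M\<close> is compared with
    \<open>r1 * ln 2\<close>.\<close>
  define C where "C = (C1 + C2) * (1 / ln 2 + 1) + 2 * M / (r1 * ln 2)"
  show ?thesis
  proof (rule log_lipschitz_onI[OF M_K])
    fix x y assume xy: "x \<in> K" "y \<in> K" "x \<noteq> y" "norm (x - y) \<le> 1 / 2"
    define h where "h = norm (x - y)"
    have h: "0 < h" "h \<le> 1 / 2" using xy by (auto simp: h_def)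
    \<comment> \<open>This lower bound lets the logarithm absorb the additive constant 1 of the
      modulus.\<close>
    have ln: "ln 2 \<le> ln (1 / h)" using h by (subst ln_le_cancel_iff) (auto simp: field_simps)
    have ln0: "0 < ln (1 / h)" using ln ln_gt_zero[of "2::real"] by linarith
    show "norm (U x - U y) \<le> C * (norm (x - y) * ln (1 / norm (x - y)))"
      unfolding h_def[symmetric]
    proof (cases "h \<le> r1")
      case True
      have "norm (U x - U y) \<le> (C1 + C2) * (h * (1 + ln (r1 / h)))"
        using C1(2)[of y x] C2(2)[of y x] xy True K norm_blinfun_complex_le[of "U x - U y"]
        by (auto simp: h_def blinfun.diff_left subset_iff distrib_right)
      also have "\<dots> \<le> (C1 + C2) * (h * ((1 / ln 2 + 1) * ln (1 / h)))"
      proof (intro mult_left_mono)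
        have "ln (r1 / h) \<le> ln (1 / h)"
          using h r1 by (subst ln_le_cancel_iff) (auto simp: divide_right_mono)
        moreover have "1 \<le> 1 / ln 2 * ln (1 / h)" using ln by simp
        ultimately show "1 + ln (r1 / h) \<le> (1 / ln 2 + 1) * ln (1 / h)"
          unfolding distrib_right by linarith
      qed (use h C1 C2 in auto)
      also have "\<dots> = (C1 + C2) * (1 / ln 2 + 1) * (h * ln (1 / h))" by (simp only: mult_ac)
      also have "\<dots> \<le> C * (h * ln (1 / h))"
        unfolding C_def using M_nonneg r1 h ln0 by (intro mult_right_mono) auto
      finally show "norm (U x - U y) \<le> C * (h * ln (1 / h))" .
    next
      case False
      have "norm (U x - U y) \<le> 2 * M"
        using norm_triangle_ineq4[of "U x" "U y"] M_K[OF xy(1)] M_K[OF xy(2)] by linarith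
      also have "\<dots> = 2 * M / (r1 * ln 2) * (r1 * ln 2)" using r1 by simp
      also have "\<dots> \<le> 2 * M / (r1 * ln 2) * (h * ln (1 / h))"
        using False ln r1 M_nonneg h by (intro mult_left_mono mult_mono) auto
      also have "\<dots> \<le> C * (h * ln (1 / h))"
        unfolding C_def using C1(1) C2(1) h ln0 by (intro mult_right_mono) auto
      finally show "norm (U x - U y) \<le> C * (h * ln (1 / h))" .
    qed
  qed
qed

section \<open>The differential and the partial derivatives\<close>

lemma has_derivative_differential:
  assumes "u differentiable at z"
  shows "(u has_derivative blinfun_apply (differential u z)) (at z)"
  using assms unfolding frechet_derivative_works differential_def
  by (simp add: bounded_linear_Blinfun_apply has_derivative_bounded_linear)

lemma partial_x_eq_differential:
  assumes "u differentiable at z"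
  shows "partial_x u z = differential u z 1"
  unfolding partial_x_def
proof (rule vector_derivative_at)
  have "((\<lambda>t. Complex t (Im z)) has_derivative (\<lambda>s. s *\<^sub>R 1)) (at (Re z))"
    unfolding Complex_eq by (auto intro!: derivative_eq_intros simp: scaleR_conv_of_real)
  moreover have "(u has_derivative blinfun_apply (differential u z)) (at (Complex (Re z) (Im z)))"
    using has_derivative_differential[OF assms] by simp
  ultimately show "((\<lambda>t. u (Complex t (Im z))) has_vector_derivative differential u z 1) (at (Re z))"
    unfolding has_vector_derivative_def
    by (rule has_derivative_eq_rhs[OF has_derivative_compose]) (simp add: blinfun.scaleR_right fun_eq_iff)
qed

lemma partial_y_eq_differential:
  assumes "u differentiable at z"
  shows "partial_y u z = differential u z \<i>"
  unfolding partial_y_def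
proof (rule vector_derivative_at)
  have "((\<lambda>t. Complex (Re z) t) has_derivative (\<lambda>s. s *\<^sub>R \<i>)) (at (Im z))"
    unfolding Complex_eq by (auto intro!: derivative_eq_intros simp: scaleR_conv_of_real mult.commute)
  moreover have "(u has_derivative blinfun_apply (differential u z)) (at (Complex (Re z) (Im z)))"
    using has_derivative_differential[OF assms] by simp
  ultimately show "((\<lambda>t. u (Complex (Re z) t)) has_vector_derivative differential u z \<i>) (at (Im z))"
    unfolding has_vector_derivative_def
    by (rule has_derivative_eq_rhs[OF has_derivative_compose]) (simp add: blinfun.scaleR_right fun_eq_iff)
qed

theorem theoremC:
  fixes n :: nat
    and J :: "real ^ 'm \<Rightarrow> real ^ 'm ^ 'm"
    and u :: "complex \<Rightarrow> real ^ 'm"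
  assumes "CARD('m) = 2 * n"
    and "almost_complex_structure J"
    and "\<exists>L. L-lipschitz_on UNIV J"
    and "J_holomorphic_on J (ball 0 1) u"
  shows "C1_LnLip_on (ball 0 1) u"
proof -
  define U where "U = differential u"
  have C1: "C1_on (ball 0 1) u"
    and eq: "\<And>z. z \<in> ball 0 1 \<Longrightarrow> partial_x u z + J (u z) *v partial_y u z = 0"
    using assms(4) by (auto simp: J_holomorphic_on_def)
  then have diff: "\<And>z. z \<in> ball 0 1 \<Longrightarrow> u differentiable at z" and cont: "continuous_on (ball 0 1) U"
    by (auto simp: C1_on_def U_def)
  have U_1: "U z 1 = - (J (u z) *v U z \<i>)" if "z \<in> ball 0 1" for z
    using eq[OF that] diff[OF that]
    by (simp add: partial_x_eq_differential partial_y_eq_differential U_def eq_neg_iff_add_eq_0)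
  \<comment> \<open>Writing \<open>- mat 1\<close> as \<open>0 - mat 1\<close> lets the rule for
    differences handle the negation.\<close>
  have J2: "J p *v (J p *v x) = - x" for p x
    using assms(2) matrix_vector_mult_diff_rdistrib[of 0 "mat 1" x]
    by (simp add: almost_complex_structure_def matrix_vector_mul_assoc)
  have U_ii: "U z \<i> = J (u z) *v U z 1" if "z \<in> ball 0 1" for z
    using matrix_vector_mult_diff_distrib[of "J (u z)" 0 "J (u z) *v U z \<i>"] by (simp add: U_1[OF that] J2)
  obtain L where L: "L-lipschitz_on UNIV J" using assms(3) by blast
  have "log_lipschitz_on K U" if K: "compact K" "K \<subseteq> ball 0 1" for K
  proof -
    \<comment> \<open>The largest norm attained on \<open>K\<close>, or 0 if \<open>K\<close> is
      empty.\<close>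
    obtain R where R: "0 \<le> R" "R < 1" "K \<subseteq> cball 0 R"
    proof (cases "K = {}")
      case False
      then obtain x where "x \<in> K" "\<And>y. y \<in> K \<Longrightarrow> norm y \<le> norm x"
        using continuous_attains_sup[OF K(1), of norm] continuous_on_norm_id by blast
      then show ?thesis using K(2) that[of "norm x"] by (auto simp: subset_iff)
    qed (use that[of 0] in simp)
    \<comment> \<open>A fifth of the gap to the unit circle, so that four times it still leaves a
      margin.\<close>
    define r0 where "r0 = (1 - R) / 5"
    have r0: "0 < r0" "R + 4 * r0 < 1" using R by (auto simp: r0_def field_simps)
    have "bounded (U ` cball 0 (R + 4 * r0))"
      using r0 by (intro compact_imp_bounded compact_continuous_image continuous_on_subset[OF cont]) auto
    then obtain M where "\<forall>x \<in> U ` cball 0 (R + 4 * r0). norm x \<le> M"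
      unfolding bounded_iff by blast
    then have "norm (U z) \<le> M" if "norm z \<le> R + 4 * r0" for z using that by simp
    then interpret j_disc u U J L R r0 M
      using diff cont U_1 U_ii L R(1) r0 has_derivative_differential[of u]
      by unfold_locales (auto simp: U_def)
    show ?thesis by (rule log_lipschitz_on_U[OF R(3)])
  qed
  then show ?thesis using C1 by (auto simp: C1_LnLip_on_def U_def)
qed

end
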